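(* Let $G$ and $H$ be finite abelian groups. Then $G\cong H$ if and only if there exists an integer $n\geq 2$ such that the subgroup lattices $L(G^n)$ and $L(H^n)$ are isomorphic as lattices.
   Context: For a group $K$, $L(K)$ denotes the lattice of all subgroups of $K$ ordered by inclusion, and $K^n$ denotes the direct product of $n$ copies of $K$. *)

theory Defs
  imports "HOL-Algebra.Algebra"
begin

definition group_power :: "('a, 'b) monoid_scheme \<Rightarrow> nat \<Rightarrow> (nat \<Rightarrow> 'a) monoid" where
  "group_power K n = product_group {..<n} (\<lambda>_. K)"

definition subgroups :: "('a, 'b) monoid_scheme \<Rightarrow> 'a set set" where
  "subgroups K = {A. subgroup A K}"

definition subgroup_lattice_iso ::
  "('a, 'b) monoid_scheme \<Rightarrow> ('c, 'd) monoid_scheme \<Rightarrow> ('a set \<Rightarrow> 'c set) \<Rightarrow> bool" where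
  "subgroup_lattice_iso K1 K2 f \<longleftrightarrow>
     bij_betw f (subgroups K1) (subgroups K2) \<and>
     (\<forall>A\<in>subgroups K1. \<forall>B\<in>subgroups K1. f (A \<inter> B) = f A \<inter> f B) \<and>
     (\<forall>A\<in>subgroups K1. \<forall>B\<in>subgroups K1.
        f (generate K1 (A \<union> B)) = generate K2 (f A \<union> f B))"

definition subgroup_lattices_isomorphic ::
  "('a, 'b) monoid_scheme \<Rightarrow> ('c, 'd) monoid_scheme \<Rightarrow> bool" where
  "subgroup_lattices_isomorphic K1 K2 \<longleftrightarrow> (\<exists>f. subgroup_lattice_iso K1 K2 f)"

end

theory Submission
  imports Defs
begin

text \<open>A subgroup is cyclic of prime power order \<open>p ^ k\<close> for some prime \<open>p\<close>, \<open>k > 0\<close>, exactly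
  when the subgroups below it form a chain with \<open>k + 1\<close> members. The prime itself can be read off the
  lattice of \<open>G\<^sup>n\<close> because, for \<open>n \<ge> 2\<close>, every subgroup of order \<open>p\<close> has a partner of the same
  order, and the join of the two contains exactly \<open>p + 3\<close> subgroups. So an isomorphism of the lattices
  preserves the number of cyclic subgroups of each prime power order, hence the number of elements
  of that order, hence \<open>\<bar>G\<^sup>n[m]\<bar> = \<bar>G[m]\<bar> ^ n\<close> for all prime powers \<open>m\<close> and then \<open>\<bar>G[m]\<bar>\<close> for all
  \<open>m\<close>. These numbers determine a finite abelian group: splitting off a cyclic summand of maximal
  order divides each of them by a known factor.\<close>

section \<open>Torsion and the classification of finite abelian groups\<close>

text \<open>A chain carries its length but not its prime: the groups of order 2 and 3 have
  isomorphic subgroup lattices, so the equivalence would fail for n = 1. A second factor makes room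
  for a plane over the field with p elements; p + 3 counts its p + 1 lines together with the trivial
  subgroup and the plane itself. Subgroups of distinct prime orders p and q join to a cyclic group
  of order pq with four subgroups, and 4 < p + 3, so the two cases cannot be confused even before
  the primes of the images are known to agree. For a longer chain the prime is read off from its
  member of order p. The lattice isomorphism need not come from a group isomorphism, so only
  cardinalities are carried over: a cyclic group of order m has as many generators as the totient of
  m, which turns counts of cyclic subgroups into counts of elements. Passing from G^n back to G is
  the extraction of an n-th root of a natural number.\<close>

definition torsion :: "('a, 'b) monoid_scheme \<Rightarrow> nat \<Rightarrow> 'a set" where
  "torsion G m = {x \<in> carrier G. x [^]\<^bsub>G\<^esub> m = \<one>\<^bsub>G\<^esub>}"

lemma (in group) torsion_iff_ord_dvd: "x \<in> torsion G m \<longleftrightarrow> x \<in> carrier G \<and> ord x dvd m"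
  unfolding torsion_def using pow_eq_id by auto

lemma (in comm_group) subgroup_torsion: "subgroup (torsion G m) G"
  by (rule subgroupI) (auto simp: torsion_def pow_mult_distrib m_comm nat_pow_inv)

lemma (in group) torsion_subgroup_generated:
  assumes "subgroup B G"
  shows "torsion (subgroup_generated G B) m = B \<inter> torsion G m"
  using assms subgroup.subset[OF assms]
  by (auto simp: torsion_def subgroup.carrier_subgroup_generated_subgroup pow_subgroup_generated)

lemma (in comm_group) card_set_mult_disjoint:
  assumes A: "subgroup A G" and B: "subgroup B G" and AB: "A \<inter> B \<subseteq> {\<one>}"
  shows "card (A <#> B) = card A * card B"
proof -
  interpret group_disjoint_sum G A B
    using A B by (simp add: group_disjoint_sum_def group_axioms)
  have "inj_on (\<lambda>(x, y). x \<otimes> y) (A \<times> B)"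
    using AB cancel by (auto simp: inj_on_def)
  moreover have "(\<lambda>(x, y). x \<otimes> y) ` (A \<times> B) = A <#> B"
    by (auto simp: set_mult_def)
  ultimately show ?thesis
    by (metis card_cartesian_product card_image)
qed

text \<open>In an abelian group (x y)^m = x^m y^m, and a product of an element of \<open>A\<close>
  and one of \<open>B\<close> is trivial only if both are. Torsion therefore splits along the sum,
  so that the contribution of one summand can be cancelled.\<close>

lemma (in comm_group) card_torsion_direct_sum:
  assumes A: "subgroup A G" and B: "subgroup B G" and AB: "A \<inter> B \<subseteq> {\<one>}"
    and sum: "A <#> B = carrier G"
  shows "card (torsion G m) = card (A \<inter> torsion G m) * card (B \<inter> torsion G m)"
proof -
  interpret group_disjoint_sum G A B
    using A B by (simp add: group_disjoint_sum_def group_axioms)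
  have eq: "torsion G m = (A \<inter> torsion G m) <#> (B \<inter> torsion G m)"
  proof
    show "torsion G m \<subseteq> (A \<inter> torsion G m) <#> (B \<inter> torsion G m)"
    proof
      fix z assume z: "z \<in> torsion G m"
      then obtain x y where xy: "x \<in> A" "y \<in> B" "z = x \<otimes> y"
        using sum unfolding torsion_def set_mult_def by blast
      then have c: "x \<in> carrier G" "y \<in> carrier G"
        using A B subgroup.subset by blast+
      have "x [^] m \<otimes> y [^] m = \<one>"
        using z xy c by (simp add: torsion_def pow_mult_distrib m_comm)
      moreover have "x [^] m \<in> A" "y [^] m \<in> B"
        using xy A B by (metis int_pow_int subgroup_int_pow_closed)+
      ultimately have "x [^] m = \<one>" "y [^] m = \<one>"
        using AB sub_id_iff by blast+
      then have "x \<in> A \<inter> torsion G m" "y \<in> B \<inter> torsion G m"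
        using xy c by (auto simp: torsion_def)
      then show "z \<in> (A \<inter> torsion G m) <#> (B \<inter> torsion G m)"
        unfolding xy set_mult_def by blast
    qed
    show "(A \<inter> torsion G m) <#> (B \<inter> torsion G m) \<subseteq> torsion G m"
      using subgroup.m_closed[OF subgroup_torsion] by (auto simp: set_mult_def)
  qed
  have "subgroup (A \<inter> torsion G m) G" "subgroup (B \<inter> torsion G m) G"
    using A B subgroup_torsion subgroups_Inter_pair by auto
  moreover have "A \<inter> torsion G m \<inter> (B \<inter> torsion G m) \<subseteq> {\<one>}"
    using AB by blast
  ultimately have "card ((A \<inter> torsion G m) <#> (B \<inter> torsion G m)) =
      card (A \<inter> torsion G m) * card (B \<inter> torsion G m)"
    by (intro card_set_mult_disjoint)
  then show ?thesis
    by (simp only: eq[symmetric])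
qed

lemma (in comm_group) card_torsion_mult:
  assumes "coprime a b"
  shows "card (torsion G (a * b)) = card (torsion G a) * card (torsion G b)"
proof -
  have "torsion G a \<inter> torsion G b \<subseteq> {\<one>}"
  proof
    fix x assume "x \<in> torsion G a \<inter> torsion G b"
    then have "x \<in> carrier G" "ord x dvd gcd a b"
      by (auto simp: torsion_iff_ord_dvd)
    then show "x \<in> {\<one>}"
      using assms ord_eq_1[of x] by (simp only: coprime_iff_gcd_eq_1 nat_dvd_1_iff_1) simp
  qed
  moreover have "torsion G (a * b) = torsion G a <#> torsion G b"
  proof
    show "torsion G (a * b) \<subseteq> torsion G a <#> torsion G b"
    proof
      fix z assume "z \<in> torsion G (a * b)"
      then have z: "z \<in> carrier G" and d: "ord z dvd a * b"
        by (auto simp: torsion_iff_ord_dvd)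
      \<comment> \<open>The Bezout identity writes \<open>z\<close> as the product of its powers
        with exponents v b and u a. The former is killed by a and the latter by b, since
        \<open>z\<close> is killed by a b.\<close>
      obtain u v :: int where uv: "u * int a + v * int b = 1"
        using assms bezout_int[of "int a" "int b"] by (metis coprime_imp_gcd_eq_1 coprime_int_iff)
      have "z = z [^] (u * int a + v * int b)"
        using z uv by simp
      also have "\<dots> = z [^] (v * int b) \<otimes> z [^] (u * int a)"
        using z by (simp add: int_pow_mult m_comm)
      finally have "z = z [^] (v * int b) \<otimes> z [^] (u * int a)" .
      moreover have "(z [^] (v * int b)) [^] a = \<one>" "(z [^] (u * int a)) [^] b = \<one>"
        using z d by (auto simp flip: int_pow_int simp: int_pow_pow int_pow_eq_id dvd_mult mult.assoc)
          (metis dvd_mult int_dvd_int_iff mult.commute of_nat_mult)+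
      ultimately have "z [^] (v * int b) \<in> torsion G a" "z [^] (u * int a) \<in> torsion G b"
          "z = z [^] (v * int b) \<otimes> z [^] (u * int a)"
        using z by (simp_all add: torsion_def)
      then show "z \<in> torsion G a <#> torsion G b"
        unfolding set_mult_def by blast
    qed
    show "torsion G a <#> torsion G b \<subseteq> torsion G (a * b)"
    proof
      fix z assume "z \<in> torsion G a <#> torsion G b"
      then obtain x y where xy: "x \<in> torsion G a" "y \<in> torsion G b" "z = x \<otimes> y"
        by (auto simp: set_mult_def)
      moreover have "x \<in> torsion G (a * b)" "y \<in> torsion G (a * b)"
        using xy by (auto simp: torsion_iff_ord_dvd)
      ultimately show "z \<in> torsion G (a * b)"
        using subgroup.m_closed[OF subgroup_torsion] by blast
    qed
  qed
  ultimately show ?thesis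
    using card_set_mult_disjoint subgroup_torsion by metis
qed

text \<open>Every positive m is built from prime powers by splitting off the full power of a prime
  divisor, which is coprime to the remaining factor.\<close>

lemma card_torsion_eqI:
  assumes G: "comm_group G" "finite (carrier G)" and H: "comm_group H" "finite (carrier H)"
    and eq: "\<And>p k. Factorial_Ring.prime p \<Longrightarrow> card (torsion G (p ^ k)) = card (torsion H (p ^ k))"
  shows "card (torsion G m) = card (torsion H m)"
proof -
  interpret G: comm_group G by fact
  interpret H: comm_group H by fact
  have pos: "card (torsion G m) = card (torsion H m)" if "m > 0" for m
    using that
  proof (induction m rule: less_induct)
    case (less m)
    show ?case
    proof (cases "m = 1")
      case True
      then show ?thesis using eq[of 2 0] by simp
    next
      case False
      then obtain p where p: "Factorial_Ring.prime p" "p dvd m"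
        using prime_factor_nat by blast
      obtain n where n: "m = p ^ multiplicity p m * n" "\<not> p dvd n"
        using multiplicity_decompose'[of m p] p less.prems not_prime_unit by (metis not_gr0)
      have "multiplicity p m > 0"
        using p less.prems by (simp add: prime_multiplicity_gt_zero_iff)
      then have "1 < p ^ multiplicity p m"
        using one_less_power[OF prime_gt_1_nat[OF p(1)]] by simp
      moreover have n0: "n > 0"
        using n less.prems by (metis mult_0_right not_gr0)
      ultimately have "n < p ^ multiplicity p m * n"
        by simp
      then have "n < m"
        by (simp only: n(1)[symmetric])
      then have "card (torsion G n) = card (torsion H n)"
        using n0 by (rule less.IH)
      moreover have co: "coprime (p ^ multiplicity p m) n"
        using p n by (simp add: prime_imp_coprime)
      ultimately show ?thesis
        using eq[OF p(1), of "multiplicity p m"] G.card_torsion_mult[OF co] H.card_torsion_mult[OF co]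
        by (simp only: n(1)[symmetric])
    qed
  qed
  \<comment> \<open>Exponent 0 gives the whole group. It is replaced by a positive exponent that is
    a multiple of all element orders in both groups.\<close>
  have "torsion G 0 = torsion G (order G * order H)" "torsion H 0 = torsion H (order G * order H)"
    using G.ord_dvd_group_order H.ord_dvd_group_order
    by (auto simp: G.torsion_iff_ord_dvd H.torsion_iff_ord_dvd)
  moreover have "order G * order H > 0"
    using G H G.order_gt_0_iff_finite H.order_gt_0_iff_finite by simp
  ultimately show ?thesis
    using pos by (metis gr0I)
qed

section \<open>Elements of maximal order and the cyclic summands they generate\<close>

lemma (in comm_group) ord_mult_coprime:
  assumes x: "x \<in> carrier G" and y: "y \<in> carrier G" and co: "coprime (ord x) (ord y)"
  shows "ord (x \<otimes> y) = ord x * ord y"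
proof -
  have "(x \<otimes> y) [^] n = \<one> \<longleftrightarrow> ord x * ord y dvd n" for n :: nat
  proof
    assume "(x \<otimes> y) [^] n = \<one>"
    then have eq: "x [^] n = inv (y [^] n)"
      using x y by (simp add: pow_mult_distrib m_comm inv_equality)
    then have "(x [^] n) [^] ord y = \<one>"
      using y by (metis inv_one nat_pow_closed nat_pow_inv nat_pow_one nat_pow_pow mult.commute pow_ord_eq_1)
    then have "ord x dvd n * ord y"
      using x by (simp add: nat_pow_pow pow_eq_id)
    then have 1: "ord x dvd n"
      using co coprime_dvd_mult_left_iff by blast
    then have "y [^] n = \<one>"
      using eq x y by (metis pow_eq_id inv_eq_1_iff nat_pow_closed)
    then show "ord x * ord y dvd n"
      using 1 y co by (simp add: pow_eq_id divides_mult)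
  next
    assume "ord x * ord y dvd n"
    then have "ord x dvd n" "ord y dvd n"
      by (auto dest: dvd_mult_left dvd_mult_right)
    then show "(x \<otimes> y) [^] n = \<one>"
      using x y by (metis l_one m_comm one_closed pow_eq_id pow_mult_distrib)
  qed
  then show ?thesis
    using x y by (metis m_closed ord_unique)
qed

text \<open>An element \<open>g\<close> of maximal order works: if some prime occurred in the order
  of x to a higher power than in that of \<open>g\<close>, the p-part of x combined with the
  prime-to-p part of \<open>g\<close> would have larger order.\<close>

lemma (in comm_group) obtain_exponent_element:
  assumes fin: "finite (carrier G)"
  obtains g where "g \<in> carrier G" "\<And>x. x \<in> carrier G \<Longrightarrow> ord x dvd ord g"
proof -
  have "Max (ord ` carrier G) \<in> ord ` carrier G"
    using fin by (intro Max_in) auto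
  then obtain g where g: "g \<in> carrier G" and gmax: "ord g = Max (ord ` carrier G)"
    by (metis imageE)
  have max: "ord x \<le> ord g" if "x \<in> carrier G" for x
    using that fin gmax by simp
  have "ord x dvd ord g" if x: "x \<in> carrier G" for x
  proof (rule ccontr)
    assume nd: "\<not> ord x dvd ord g"
    have pos: "ord x > 0" "ord g > 0"
      using ord_ge_1 fin x g by (simp_all add: Suc_le_eq)
    then obtain p where p: "Factorial_Ring.prime p" and less: "multiplicity p (ord g) < multiplicity p (ord x)"
      using nd multiplicity_le_imp_dvd[of "ord x" "ord g"] by (metis not_le not_gr0)
    define a b where "a = multiplicity p (ord x)" and "b = multiplicity p (ord g)"
    obtain c where c: "ord g = p ^ b * c" "\<not> p dvd c"
      using multiplicity_decompose'[of "ord g" p] p pos not_prime_unit unfolding b_def by (metis not_gr0)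
    obtain d where d: "ord x = p ^ a * d"
      unfolding a_def using multiplicity_dvd by (metis dvdE)
    have p0: "p > 0" using p prime_gt_0_nat by blast
    \<comment> \<open>Raising \<open>g\<close> to \<open>p ^ b\<close> strips its p-part, raising
      \<open>x\<close> to \<open>d\<close> leaves only its p-part; the orders are coprime and so
      multiply.\<close>
    have "ord (g [^] (p ^ b)) = c"
      using c g p0 by (subst ord_pow) auto
    moreover have "ord (x [^] d) = p ^ a"
      using d x pos by (subst ord_pow) auto
    moreover have "coprime (p ^ a) c"
      using p c by (simp add: prime_imp_coprime)
    ultimately have "ord (x [^] d \<otimes> g [^] (p ^ b)) = p ^ a * c"
      using x g by (subst ord_mult_coprime) auto
    then have "p ^ a * c \<le> ord g"
      using max[of "x [^] d \<otimes> g [^] (p ^ b)"] x g by simp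
    moreover have "p ^ b < p ^ a"
      using less p prime_gt_1_nat unfolding a_def b_def by (intro power_strict_increasing) auto
    ultimately show False
      using c pos by simp
  qed
  then show thesis using g that by blast
qed

text \<open>The complement is a subgroup \<open>B\<close> maximal among those meeting <g> trivially.
  An element x outside the product of <g> and \<open>B\<close> could be altered by a power of
  \<open>g\<close> into an element that enlarges \<open>B\<close> and still keeps the intersection
  trivial.\<close>

lemma (in comm_group) cyclic_direct_summand:
  assumes fin: "finite (carrier G)" and g: "g \<in> carrier G"
    and exp: "\<And>x. x \<in> carrier G \<Longrightarrow> ord x dvd ord g"
  obtains B where "subgroup B G" "generate G {g} \<inter> B \<subseteq> {\<one>}" "generate G {g} <#> B = carrier G"
proof -
  let ?C = "generate G {g}"
  have C: "subgroup ?C G"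
    using g by (intro generate_is_subgroup) simp
  have Cpow: "?C = {g [^] k | k. k \<in> (UNIV :: nat set)}"
    using generate_pow_on_finite_carrier[OF fin g] .
  let ?S = "{B. subgroup B G \<and> ?C \<inter> B \<subseteq> {\<one>}}"
  have "?S \<subseteq> Pow (carrier G)"
    using subgroup.subset by blast
  then have "finite ?S"
    using fin by (meson finite_Pow_iff finite_subset)
  moreover have "{\<one>} \<in> ?S"
    using triv_subgroup by auto
  ultimately obtain B where "B \<in> ?S" and Bmax: "\<And>B'. B' \<in> ?S \<Longrightarrow> B \<subseteq> B' \<Longrightarrow> B' = B"
    using finite_has_maximal[of ?S] by (metis (no_types, lifting) empty_iff)
  then have B: "subgroup B G" and CB: "?C \<inter> B \<subseteq> {\<one>}"
    by auto
  let ?M = "?C <#> B"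
  have M: "subgroup ?M G"
    using C B mult_subgroups by blast
  have inM: "B \<subseteq> ?M" "?C \<subseteq> ?M"
    using subgroup.one_closed[OF B] subgroup.one_closed[OF C] subgroup.subset[OF B] subgroup.subset[OF C]
    by (force simp: set_mult_def)+
  have pow_M: "x [^] (k::nat) \<in> K" if "subgroup K G" "x \<in> K" for x k K
    using that by (metis int_pow_int subgroup_int_pow_closed)
  have "carrier G \<subseteq> ?M"
  proof (rule ccontr)
    assume "\<not> carrier G \<subseteq> ?M"
    then obtain x where x: "x \<in> carrier G" "x \<notin> ?M" by blast
    \<comment> \<open>The order of \<open>x\<close> modulo \<open>?M\<close>: every exponent that
      takes \<open>x\<close> into \<open>?M\<close> is a multiple of it.\<close>
    define m where "m = (LEAST k::nat. k > 0 \<and> x [^] k \<in> ?M)"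
    have "ord x > 0 \<and> x [^] ord x \<in> ?M"
      using x ord_ge_1[OF fin] subgroup.one_closed[OF M] by (simp add: Suc_le_eq)
    then have m: "m > 0" "x [^] m \<in> ?M"
      unfolding m_def by (metis (mono_tags, lifting) LeastI)+
    have mdvd: "m dvd k" if "x [^] k \<in> ?M" for k :: nat
    proof -
      have "x [^] k = x [^] (k mod m) \<otimes> (x [^] m) [^] (k div m)"
        using x by (simp add: nat_pow_pow nat_pow_mult)
      then have "x [^] (k mod m) = x [^] k \<otimes> inv ((x [^] m) [^] (k div m))"
        using x by (simp add: inv_solve_right)
      also have "\<dots> \<in> ?M"
        using that pow_M[OF M m(2)] M by (simp add: subgroup.m_closed subgroup.m_inv_closed)
      finally have "x [^] (k mod m) \<in> ?M" .
      moreover have "k mod m < m" using m by simp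
      ultimately have "k mod m = 0"
        unfolding m_def using not_less_Least by (metis (mono_tags, lifting) gr0I)
      then show ?thesis by auto
    qed
    obtain c b where cb: "c \<in> ?C" "b \<in> B" "x [^] m = c \<otimes> b"
      using m by (auto simp: set_mult_def)
    then obtain j :: nat where j: "c = g [^] j"
      using Cpow by auto
    have bc: "b \<in> carrier G" using cb subgroup.subset[OF B] by blast
    have "m dvd ord g"
      using mdvd[of "ord g"] x exp subgroup.one_closed[OF M] pow_eq_id by metis
    then obtain q where q: "ord g = m * q" by blast
    have gpos: "ord g > 0" using ord_ge_1[OF fin g] by simp
    text \<open>The exponent of \<open>G\<close> kills \<open>x\<close>, which forces \<open>m\<close> to divide \<open>j\<close>: thus \<open>x\<close> can be
      corrected by a power of \<open>g\<close> so that its \<open>m\<close>-th power lands in \<open>B\<close>.\<close>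
    have "m dvd j"
    proof -
      have "\<one> = (x [^] m) [^] q"
        using x exp q pow_eq_id by (metis nat_pow_pow)
      also have "\<dots> = (g [^] j) [^] q \<otimes> b [^] q"
        using cb j g bc by (simp add: pow_mult_distrib m_comm)
      finally have "(g [^] j) [^] q \<otimes> b [^] q = \<one>" by simp
      moreover have "(g [^] j) [^] q \<in> ?C" "b [^] q \<in> B"
        using pow_M C B cb j by auto
      ultimately have "(g [^] j) [^] q = \<one>"
        using CB group_disjoint_sum.sub_id_iff[of G ?C B] C B by (auto simp: group_disjoint_sum_def group_axioms)
      then have "m * q dvd j * q"
        using g q by (simp add: nat_pow_pow pow_eq_id)
      then show ?thesis
        using gpos q by simp
    qed
    then obtain i where i: "j = m * i" by blast
    define y where "y = x \<otimes> inv (g [^] i)"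
    have y: "y \<in> carrier G" using x g by (simp add: y_def)
    have ym: "y [^] m = b"
    proof -
      have "y [^] m = x [^] m \<otimes> inv (g [^] j)"
        using x g i by (simp add: y_def pow_mult_distrib m_comm nat_pow_inv nat_pow_pow mult.commute)
      also have "\<dots> = b"
        using cb j g bc by (metis inv_solve_right' m_comm m_closed nat_pow_closed)
      finally show ?thesis .
    qed
    have xy: "x = y \<otimes> g [^] i"
      using x g by (simp add: y_def m_assoc)
    let ?Y = "generate G {y}"
    have Y: "subgroup ?Y G" using y by (intro generate_is_subgroup) simp
    let ?B' = "?Y <#> B"
    have B': "subgroup ?B' G" using Y B mult_subgroups by blast
    \<comment> \<open>If y^k b' lies in \<open>?C\<close>, then x^k lies in \<open>?M\<close>, so m
      divides k. Since y^m = b is in \<open>B\<close>, so is y^k, and the element falls into the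
      trivial intersection of \<open>?C\<close> and \<open>B\<close>.\<close>
    have "?C \<inter> ?B' \<subseteq> {\<one>}"
    proof
      fix z assume z: "z \<in> ?C \<inter> ?B'"
      then obtain w b' where wb: "w \<in> ?Y" "b' \<in> B" "z = w \<otimes> b'"
        by (auto simp: set_mult_def)
      then obtain k :: nat where k: "w = y [^] k"
        using generate_pow_on_finite_carrier[OF fin y] by auto
      have cc: "b' \<in> carrier G" "z \<in> carrier G"
        using wb z subgroup.subset[OF B] subgroup.subset[OF C] by auto
      have "y [^] k = z \<otimes> inv b'"
        using wb k cc y by (simp add: inv_solve_right)
      moreover have "x [^] k = y [^] k \<otimes> (g [^] i) [^] k"
        using xy y g by (simp add: pow_mult_distrib m_comm)
      ultimately have "x [^] k = (z \<otimes> inv b') \<otimes> (g [^] i) [^] k" by simp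
      moreover have "z \<in> ?M" "inv b' \<in> ?M" "(g [^] i) [^] k \<in> ?M"
        using z wb inM B Cpow g subgroup.m_inv_closed[OF B] by (auto simp: nat_pow_pow)
      ultimately have "x [^] k \<in> ?M"
        using M by (simp add: subgroup.m_closed)
      then obtain l where "k = m * l" using mdvd by blast
      then have "w = b [^] l"
        using k ym y by (metis nat_pow_pow)
      then have "z \<in> B"
        using wb cb B pow_M subgroup.m_closed by metis
      then show "z \<in> {\<one>}" using z CB by blast
    qed
    moreover have "B \<subseteq> ?B'"
      using subgroup.one_closed[OF Y] subgroup.subset[OF B] by (force simp: set_mult_def)
    moreover have "y \<in> ?Y" by (simp add: generate.incl)
    then have "y \<otimes> \<one> \<in> ?B'"
      unfolding set_mult_def using subgroup.one_closed[OF B] by blast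
    then have "y \<in> ?B'" using y by simp
    ultimately have "y \<in> B"
      using Bmax[of ?B'] B' by blast
    moreover have "g [^] i \<in> ?C" using Cpow by auto
    ultimately have "x \<in> ?M"
      using xy inM M by (metis subgroup.m_closed subsetD)
    then show False using x by simp
  qed
  then have "?M = carrier G"
    using subgroup.subset[OF M] by blast
  then show thesis using that B CB by blast
qed

lemma (in comm_group) cyclic_times_summand_iso:
  assumes g: "g \<in> carrier G" and B: "subgroup B G" "generate G {g} \<inter> B \<subseteq> {\<one>}"
    "generate G {g} <#> B = carrier G"
  shows "subgroup_generated G {g} \<times>\<times> subgroup_generated G B \<cong> G"
proof -
  have C: "subgroup (generate G {g}) G"
    using g by (intro generate_is_subgroup) simp
  interpret group_disjoint_sum G "generate G {g}" B
    using C B(1) by (simp add: group_disjoint_sum_def group_axioms)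
  have "subgroup_generated G (generate G {g}) = subgroup_generated G {g}"
    by (metis carrier_subgroup_generated subgroup_generated_restrict g Int_insert_right_if1 Int_empty_right
        subgroup_generated_def AG.carrier_subgroup_generated_subgroup)
  then show ?thesis
    using iso_group_mul[OF comm_group_axioms] B by (auto simp: is_iso_def)
qed

section \<open>Reconstruction of a finite abelian group from its torsion counts\<close>

lemma cyclic_subgroups_iso:
  assumes "group G" "group H" and g: "g \<in> carrier G" and h: "h \<in> carrier H"
    and eq: "group.ord G g = group.ord H h"
  shows "subgroup_generated G {g} \<cong> subgroup_generated H {h}"
proof -
  interpret G: group G by fact
  interpret H: group H by fact
  note cg = G.carrier_subgroup_generated_by_singleton[OF g]
    and ch = H.carrier_subgroup_generated_by_singleton[OF h]
  \<comment> \<open>The exponent is an arbitrary choice; equality of the orders makes g^i = g^j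
    equivalent to h^i = h^j, so the value is independent of it.\<close>
  define f where "f x = h [^]\<^bsub>H\<^esub> (SOME i::int. x = g [^]\<^bsub>G\<^esub> i)" for x
  have pow_eq: "g [^]\<^bsub>G\<^esub> i = g [^]\<^bsub>G\<^esub> j \<longleftrightarrow> h [^]\<^bsub>H\<^esub> i = h [^]\<^bsub>H\<^esub> j" for i j :: int
    using g h eq by (simp add: G.int_pow_eq H.int_pow_eq)
  have f: "f (g [^]\<^bsub>G\<^esub> i) = h [^]\<^bsub>H\<^esub> i" for i :: int
    unfolding f_def using pow_eq someI[of "\<lambda>j::int. g [^]\<^bsub>G\<^esub> i = g [^]\<^bsub>G\<^esub> j" i] by metis
  have "f \<in> iso (subgroup_generated G {g}) (subgroup_generated H {h})"
  proof (rule isoI)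
    show "f \<in> hom (subgroup_generated G {g}) (subgroup_generated H {h})"
      by (rule homI) (auto simp: cg ch f g h simp flip: G.int_pow_mult H.int_pow_mult)
    show "bij_betw f (carrier (subgroup_generated G {g})) (carrier (subgroup_generated H {h}))"
      by (auto simp: bij_betw_def inj_on_def cg ch f pow_eq image_image)
  qed
  then show ?thesis by (auto simp: is_iso_def)
qed

text \<open>Writing the elements of <g> as g^i with i below the order turns torsion into
  divisibility. The count depends on \<open>g\<close> only through its order, so cyclic summands of
  equal order contribute the same factor in different groups.\<close>

lemma (in group) card_cyclic_inter_torsion:
  assumes fin: "finite (carrier G)" and g: "g \<in> carrier G"
  shows "card (generate G {g} \<inter> torsion G m) = card {i. i < ord g \<and> ord g dvd i * m}"
proof -
  have pos: "ord g > 0" using ord_ge_1[OF fin g] by simp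
  then have set: "{0..ord g - 1} = {..<ord g}" by auto
  have gen: "generate G {g} = ([^]) g ` {..<ord g}"
    using generate_pow_on_finite_carrier[OF fin g] ord_elems[OF fin g] set by auto
  have "generate G {g} \<inter> torsion G m = ([^]) g ` {i. i < ord g \<and> ord g dvd i * m}"
    unfolding gen torsion_def using g by (auto simp: nat_pow_pow pow_eq_id)
  moreover have "inj_on (([^]) g) {i. i < ord g \<and> ord g dvd i * m}"
    using ord_inj[OF g] unfolding set by (rule inj_on_subset) auto
  ultimately show ?thesis by (simp add: card_image)
qed

theorem finite_comm_groups_iso_if_card_torsion_eq:
  assumes "comm_group G" "finite (carrier G)" "comm_group H" "finite (carrier H)"
    and "\<And>m. card (torsion G m) = card (torsion H m)"
  shows "G \<cong> H"
  using assms
proof (induction "card (carrier G)" arbitrary: G H rule: less_induct)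
  case (less G H)
  interpret G: comm_group G by fact
  interpret H: comm_group H by fact
  note finG = less.prems(2) and finH = less.prems(4) and eq = less.prems(5)
  obtain g where g: "g \<in> carrier G" "\<And>x. x \<in> carrier G \<Longrightarrow> G.ord x dvd G.ord g"
    using G.obtain_exponent_element[OF finG] by blast
  obtain h where h: "h \<in> carrier H" "\<And>x. x \<in> carrier H \<Longrightarrow> H.ord x dvd H.ord h"
    using H.obtain_exponent_element[OF finH] by blast
  have card: "card (carrier G) = card (carrier H)"
    using eq[of 0] by (simp add: torsion_def)
  \<comment> \<open>The counts determine the exponent: m kills a finite group exactly when its
    m-torsion has as many elements as the group. Hence the order of \<open>g\<close> kills
    \<open>H\<close>, the order of \<open>h\<close> kills \<open>G\<close>, and the two divide each
    other.\<close>
  have "torsion G (G.ord g) = carrier G"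
    using g by (auto simp: G.torsion_iff_ord_dvd)
  then have "torsion H (G.ord g) = carrier H"
    using eq[of "G.ord g"] card finH by (intro card_subset_eq) (simp_all add: torsion_def)
  moreover have "torsion H (H.ord h) = carrier H"
    using h by (auto simp: H.torsion_iff_ord_dvd)
  then have "torsion G (H.ord h) = carrier G"
    using eq[of "H.ord h"] card finG by (intro card_subset_eq) (simp_all add: torsion_def)
  ultimately have ord: "G.ord g = H.ord h"
    using g h by (metis G.torsion_iff_ord_dvd H.torsion_iff_ord_dvd dvd_antisym)
  obtain B where B: "subgroup B G" "generate G {g} \<inter> B \<subseteq> {\<one>\<^bsub>G\<^esub>}"
      "generate G {g} <#>\<^bsub>G\<^esub> B = carrier G"
    using G.cyclic_direct_summand[OF finG g] by blast
  obtain D where D: "subgroup D H" "generate H {h} \<inter> D \<subseteq> {\<one>\<^bsub>H\<^esub>}"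
      "generate H {h} <#>\<^bsub>H\<^esub> D = carrier H"
    using H.cyclic_direct_summand[OF finH h] by blast
  have sg: "subgroup (generate G {g}) G" "subgroup (generate H {h}) H"
    using g h by (auto intro!: G.generate_is_subgroup H.generate_is_subgroup)
  show ?case
  proof (cases "G.ord g = 1")
    case True
    then have "x = \<one>\<^bsub>G\<^esub>" if "x \<in> carrier G" for x
      using that g(2) G.ord_eq_1 by (metis nat_dvd_1_iff_1)
    then have "carrier G = {\<one>\<^bsub>G\<^esub>}" by blast
    moreover have "x = \<one>\<^bsub>H\<^esub>" if "x \<in> carrier H" for x
      using that h(2) True ord H.ord_eq_1 by (metis nat_dvd_1_iff_1)
    then have "carrier H = {\<one>\<^bsub>H\<^esub>}" by blast
    ultimately have "bij_betw (\<lambda>x. \<one>\<^bsub>H\<^esub>) (carrier G) (carrier H)"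
      by (simp add: bij_betw_def)
    then have "(\<lambda>x. \<one>\<^bsub>H\<^esub>) \<in> iso G H"
      by (intro isoI homI) simp_all
    then show ?thesis by (auto simp: is_iso_def)
  next
    case False
    let ?GB = "subgroup_generated G B" and ?HD = "subgroup_generated H D"
    have cB: "carrier ?GB = B" "carrier ?HD = D"
      using B D by (auto simp: subgroup.carrier_subgroup_generated_subgroup)
    have "card (generate G {g} <#>\<^bsub>G\<^esub> B) = G.ord g * card B"
      using G.card_set_mult_disjoint[OF sg(1) B(1,2)] G.generate_pow_card[OF g(1)] by simp
    moreover have "card B > 0"
      using B finG by (metis card_gt_0_iff empty_iff finite_subset subgroup.one_closed subgroup.subset)
    moreover have "G.ord g > 1"
      using False G.ord_ge_1[OF finG g(1)] by simp
    ultimately have "card (carrier ?GB) < card (carrier G)"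
      using B(3) cB by simp
    moreover have "comm_group ?GB" "comm_group ?HD"
      using G.abelian_subgroup_generated[OF less.prems(1)] H.abelian_subgroup_generated[OF less.prems(3)] by auto
    moreover have "finite (carrier ?GB)" "finite (carrier ?HD)"
      using cB B D finG finH by (metis finite_subset subgroup.subset)+
    moreover have "card (torsion ?GB m) = card (torsion ?HD m)" for m
    proof -
      have "card (generate G {g} \<inter> torsion G m) = card (generate H {h} \<inter> torsion H m)"
        using G.card_cyclic_inter_torsion[OF finG g(1)] H.card_cyclic_inter_torsion[OF finH h(1)] ord by simp
      \<comment> \<open>The common cyclic factor may be cancelled because it is nonzero: the
        identity is always counted.\<close>
      moreover have "card (generate G {g} \<inter> torsion G m) > 0"
      proof -
        have "\<one>\<^bsub>G\<^esub> \<in> generate G {g} \<inter> torsion G m"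
          by (simp add: generate.one torsion_def)
        moreover have "finite (generate G {g} \<inter> torsion G m)"
          using finG by (auto simp: torsion_def intro: finite_subset)
        ultimately show ?thesis by (auto simp: card_gt_0_iff)
      qed
      ultimately have "card (B \<inter> torsion G m) = card (D \<inter> torsion H m)"
        using G.card_torsion_direct_sum[OF sg(1) B, of m] H.card_torsion_direct_sum[OF sg(2) D, of m] eq[of m]
        by simp
      then show ?thesis
        using B D by (simp add: G.torsion_subgroup_generated H.torsion_subgroup_generated)
    qed
    ultimately have "?GB \<cong> ?HD"
      using less.hyps by blast
    then obtain f2 where f2: "f2 \<in> iso ?GB ?HD" by (auto simp: is_iso_def)
    have "subgroup_generated G {g} \<cong> subgroup_generated H {h}"
      by (rule cyclic_subgroups_iso[OF G.group_axioms H.group_axioms g(1) h(1) ord])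
    then obtain f1 where f1: "f1 \<in> iso (subgroup_generated G {g}) (subgroup_generated H {h})"
      by (auto simp: is_iso_def)
    have "(\<lambda>(x, y). (f1 x, f2 y)) \<in>
        iso (subgroup_generated G {g} \<times>\<times> ?GB) (subgroup_generated H {h} \<times>\<times> ?HD)"
      using f1 f2 iso_paired2[OF G.group_subgroup_generated G.group_subgroup_generated] by blast
    then have mid: "subgroup_generated G {g} \<times>\<times> ?GB \<cong> subgroup_generated H {h} \<times>\<times> ?HD"
      by (auto simp: is_iso_def)
    have "G \<cong> subgroup_generated G {g} \<times>\<times> ?GB"
      using group.iso_sym[OF DirProd_group[OF G.group_subgroup_generated G.group_subgroup_generated]
          G.cyclic_times_summand_iso[OF g(1) B]] .
    then show ?thesis
      by (rule iso_trans[OF _ iso_trans[OF mid H.cyclic_times_summand_iso[OF h(1) D]]])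
  qed
qed

section \<open>Cyclic subgroups in the subgroup lattice\<close>

definition below :: "('a, 'b) monoid_scheme \<Rightarrow> 'a set \<Rightarrow> 'a set set" where
  "below K C = {A \<in> subgroups K. A \<subseteq> C}"

text \<open>Written as an image, so that the elements of order n map onto it by x to <x> and can be
  counted by fibres.\<close>

definition cyclic_subgroups :: "('a, 'b) monoid_scheme \<Rightarrow> nat \<Rightarrow> 'a set set" where
  "cyclic_subgroups K n = (\<lambda>x. generate K {x}) ` {x \<in> carrier K. group.ord K x = n}"

lemma (in group) card_subgroup_dvd:
  assumes A: "subgroup A G" and B: "subgroup B G" and "A \<subseteq> B"
  shows "card A dvd card B"
proof -
  have "subgroup A (G\<lparr>carrier := B\<rparr>)"
    using assms subgroup_incl by blast
  from group.lagrange[OF subgroup_imp_group[OF B] this] show ?thesis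
    by (intro dvdI[where k = "card (rcosets\<^bsub>G\<lparr>carrier := B\<rparr>\<^esub> A)"]) (simp add: order_def mult.commute)
qed

lemma (in group) subgroup_subset_torsion:
  assumes A: "subgroup A G"
  shows "A \<subseteq> torsion G (card A)"
proof
  fix a assume a: "a \<in> A"
  then have "a \<in> carrier G" using subgroup.subset[OF A] by blast
  moreover have "generate G {a} \<subseteq> A"
    using a A generate_subgroup_incl by blast
  then have "ord a dvd card A"
    using card_subgroup_dvd[OF generate_is_subgroup A] \<open>a \<in> carrier G\<close>
    by (simp add: generate_pow_card)
  ultimately show "a \<in> torsion G (card A)"
    by (simp add: torsion_iff_ord_dvd)
qed

lemma (in group) generate_singleton_subset:
  "subgroup A G \<Longrightarrow> a \<in> A \<Longrightarrow> generate G {a} \<subseteq> A"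
  by (rule generate_subgroup_incl) simp_all

text \<open>In a cyclic group whose order is a multiple of d, at most d elements are killed by d,
  and a subgroup of order d consists of such elements. Subgroups of a cyclic group are thus
  determined by their cardinality.\<close>

lemma (in group) subgroup_of_cyclic_eq:
  assumes fin: "finite (carrier G)" and x: "x \<in> carrier G"
    and A: "subgroup A G" and sub: "A \<subseteq> generate G {x}"
  shows "A = generate G {x} \<inter> torsion G (card A)"
proof (rule card_seteq)
  let ?n = "ord x" and ?d = "card A"
  have X: "subgroup (generate G {x}) G"
    using x by (intro generate_is_subgroup) simp
  show "finite (generate G {x} \<inter> torsion G ?d)"
    using fin finite_subset[OF subgroup.subset[OF X]] by blast
  show "A \<subseteq> generate G {x} \<inter> torsion G ?d"
    using sub subgroup_subset_torsion[OF A] by blast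
  have pos: "?n > 0" using ord_ge_1[OF fin x] by simp
  have "?d dvd ?n"
    using card_subgroup_dvd[OF A X sub] generate_pow_card[OF x] by simp
  then obtain e where e: "?n = ?d * e" by blast
  \<comment> \<open>With n = d e, the condition that n divides i d means that e divides i, which
    leaves the d multiples e k with k < d.\<close>
  have "{i. i < ?n \<and> ?n dvd i * ?d} \<subseteq> (\<lambda>k. e * k) ` {..<?d}"
  proof
    fix i assume i: "i \<in> {i. i < ?n \<and> ?n dvd i * ?d}"
    then have "?d * e dvd ?d * i" "i < ?d * e"
      using e by (auto simp: mult.commute)
    then have "e dvd i" using pos e by simp
    then obtain k where "i = e * k" by blast
    then show "i \<in> (\<lambda>k. e * k) ` {..<?d}"
      using \<open>i < ?d * e\<close> pos e by (auto simp: mult.commute)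
  qed
  then have "card {i. i < ?n \<and> ?n dvd i * ?d} \<le> ?d"
    by (metis card_lessThan finite_lessThan surj_card_le)
  then show "card (generate G {x} \<inter> torsion G ?d) \<le> card A"
    by (simp add: card_cyclic_inter_torsion[OF fin x])
qed

text \<open>Injectivity is the uniqueness of a subgroup of given order. For a divisor d with
  \<open>ord x\<close> = d e, the power x^e generates a subgroup of order d.\<close>

lemma (in group) bij_betw_card_below_cyclic:
  assumes fin: "finite (carrier G)" and x: "x \<in> carrier G"
  shows "bij_betw card (below G (generate G {x})) {d. d dvd ord x}"
proof (rule bij_betwI')
  fix A B assume "A \<in> below G (generate G {x})" "B \<in> below G (generate G {x})"
  then show "card A = card B \<longleftrightarrow> A = B"
    using subgroup_of_cyclic_eq[OF fin x] by (metis (no_types, lifting) below_def mem_Collect_eq subgroups_def)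
next
  fix A assume "A \<in> below G (generate G {x})"
  then show "card A \<in> {d. d dvd ord x}"
    using card_subgroup_dvd[OF _ generate_is_subgroup] x
    by (auto simp: below_def subgroups_def generate_pow_card)
next
  fix d assume "d \<in> {d. d dvd ord x}"
  then obtain e where e: "ord x = d * e" by blast
  have X: "subgroup (generate G {x}) G"
    using x by (intro generate_is_subgroup) simp
  have pos: "ord x > 0" using ord_ge_1[OF fin x] by simp
  let ?A = "generate G {x [^] e}"
  have "x [^] e \<in> generate G {x}"
    using X by (metis generate.incl int_pow_int singletonI subgroup_int_pow_closed)
  then have "?A \<subseteq> generate G {x}"
    using X by (rule generate_singleton_subset[rotated])
  moreover have "card ?A = d"
  proof -
    have "ord (x [^] e) = ord x div e"
      using e pos x by (intro ord_pow) auto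
    then show ?thesis
      using e pos x by (simp flip: generate_pow_card)
  qed
  moreover have "subgroup ?A G"
    using x by (intro generate_is_subgroup) simp
  ultimately show "\<exists>A\<in>below G (generate G {x}). d = card A"
    by (auto simp: below_def subgroups_def)
qed

text \<open>The divisors of p^k form a chain of length k + 1. Divisibility of cardinalities becomes
  inclusion because each subgroup is the part of \<open>C\<close> killed by its cardinality.\<close>

lemma (in group) below_cyclic_prime_power:
  assumes fin: "finite (carrier G)" and p: "Factorial_Ring.prime p"
    and C: "C \<in> cyclic_subgroups G (p ^ k)"
  shows "C \<in> subgroups G" and "card (below G C) = Suc k"
    and "A \<in> below G C \<Longrightarrow> B \<in> below G C \<Longrightarrow> A \<subseteq> B \<or> B \<subseteq> A"
proof -
  obtain x where x: "x \<in> carrier G" "ord x = p ^ k" "C = generate G {x}"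
    using C by (auto simp: cyclic_subgroups_def)
  show "C \<in> subgroups G"
    using x generate_is_subgroup by (simp add: subgroups_def)
  have bij: "bij_betw card (below G C) {d. d dvd p ^ k}"
    using bij_betw_card_below_cyclic[OF fin x(1)] x by simp
  have "{d. d dvd p ^ k} = (\<lambda>i. p ^ i) ` {..k}"
    using p by (auto simp: divides_primepow_nat)
  moreover have "inj_on (\<lambda>i. p ^ i) {..k}"
    using p prime_gt_1_nat by (auto simp: inj_on_def)
  ultimately show "card (below G C) = Suc k"
    using bij_betw_same_card[OF bij] by (simp add: card_image)
  show "A \<subseteq> B \<or> B \<subseteq> A" if A: "A \<in> below G C" and B: "B \<in> below G C"
  proof -
    have "card A dvd p ^ k" "card B dvd p ^ k"
      using A B bij by (auto simp: bij_betw_def)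
    then have "card A dvd card B \<or> card B dvd card A"
      using p by (metis divides_primepow_nat le_imp_power_dvd nat_le_linear)
    then have "torsion G (card A) \<subseteq> torsion G (card B) \<or> torsion G (card B) \<subseteq> torsion G (card A)"
      by (auto simp: torsion_iff_ord_dvd)
    moreover have "A = C \<inter> torsion G (card A)" "B = C \<inter> torsion G (card B)"
      using A B x subgroup_of_cyclic_eq[OF fin x(1)] by (auto simp: below_def subgroups_def)
    ultimately show ?thesis by blast
  qed
qed

text \<open>An element of maximal order generates \<open>C\<close>, because the cyclic subgroup of
  any other element is comparable with its own and no larger. The divisors of its order then form a
  chain, which excludes two distinct prime divisors.\<close>

lemma (in group) cyclic_prime_powerI:
  assumes fin: "finite (carrier G)" and C: "C \<in> subgroups G" and k: "k > 0"
    and card: "card (below G C) = Suc k"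
    and chain: "\<And>A B. A \<in> below G C \<Longrightarrow> B \<in> below G C \<Longrightarrow> A \<subseteq> B \<or> B \<subseteq> A"
  obtains p where "Factorial_Ring.prime p" "C \<in> cyclic_subgroups G (p ^ k)"
proof -
  have sC: "subgroup C G" using C by (simp add: subgroups_def)
  have finC: "finite C" using fin sC finite_subset subgroup.subset by blast
  have gen_below: "generate G {y} \<in> below G C" if "y \<in> C" for y
    using that sC subgroup.subset[OF sC] generate_singleton_subset generate_is_subgroup
    by (auto simp: below_def subgroups_def)
  have "Max (ord ` C) \<in> ord ` C"
    using finC subgroup.one_closed[OF sC] by (intro Max_in) auto
  then obtain x where x: "x \<in> C" "ord x = Max (ord ` C)" by (metis imageE)
  have xG: "x \<in> carrier G" using x sC subgroup.subset by blast
  have "C \<subseteq> generate G {x}"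
  proof
    fix y assume y: "y \<in> C"
    then have yG: "y \<in> carrier G" using sC subgroup.subset by blast
    have le: "card (generate G {y}) \<le> card (generate G {x})"
      using x y finC xG yG by (simp flip: generate_pow_card)
    have "finite (generate G {y})"
      using gen_below[OF y] finC finite_subset by (auto simp: below_def)
    then have "generate G {y} \<subseteq> generate G {x}"
      using chain[OF gen_below[OF x(1)] gen_below[OF y]] le card_seteq by blast
    then show "y \<in> generate G {x}" by (meson generate.incl singletonI subsetD)
  qed
  then have Cx: "C = generate G {x}"
    using generate_singleton_subset[OF sC x(1)] by blast
  have bij: "bij_betw card (below G C) {d. d dvd ord x}"
    using bij_betw_card_below_cyclic[OF fin xG] Cx by simp
  have dvd_chain: "d dvd e \<or> e dvd d" if "d dvd ord x" "e dvd ord x" for d e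
  proof -
    have "d \<in> card ` below G C" "e \<in> card ` below G C"
      using that bij by (simp_all add: bij_betw_def)
    then obtain A B where "A \<in> below G C" "B \<in> below G C" "d = card A" "e = card B"
      by blast
    moreover from this have "subgroup A G" "subgroup B G"
      by (simp_all add: below_def subgroups_def)
    ultimately show ?thesis
      using chain[of A B] card_subgroup_dvd by blast
  qed
  \<comment> \<open>Here k > 0 enters: \<open>C\<close> has more than one subgroup, so the order of
    its generator has a prime divisor.\<close>
  have "ord x \<noteq> 1"
    using bij_betw_same_card[OF bij] card k by (intro notI) simp
  then obtain p where p: "Factorial_Ring.prime p" "p dvd ord x"
    using prime_factor_nat by blast
  have pos: "ord x \<noteq> 0" using ord_ge_1[OF fin xG] by simp
  obtain m where m: "ord x = p ^ multiplicity p (ord x) * m" "\<not> p dvd m"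
    using multiplicity_decompose'[of "ord x" p] p pos not_prime_unit by metis
  have "m = 1"
  proof (rule ccontr)
    assume "m \<noteq> 1"
    then obtain q where q: "Factorial_Ring.prime q" "q dvd m"
      using prime_factor_nat by blast
    then have "q dvd ord x" using m(1) by (metis dvd_mult)
    then have "p = q"
      using dvd_chain[of p q] p q primes_dvd_imp_eq by blast
    then show False using q m by blast
  qed
  then obtain j where j: "ord x = p ^ j" using m(1) by simp
  then have "C \<in> cyclic_subgroups G (p ^ j)"
    using Cx xG by (auto simp: cyclic_subgroups_def)
  moreover have "j = k"
    using below_cyclic_prime_power(2)[OF fin p(1) calculation] card by simp
  ultimately show thesis using that p by blast
qed

section \<open>Subgroups of prime order and their joins\<close>

lemma (in group) prime_order_cyclic:
  assumes p: "Factorial_Ring.prime p" and P: "subgroup P G" "card P = p"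
    and x: "x \<in> P" "x \<noteq> \<one>"
  shows "generate G {x} = P" and "ord x = p"
proof -
  have xG: "x \<in> carrier G" using x P subgroup.subset by blast
  have sub: "generate G {x} \<subseteq> P" using generate_singleton_subset P x by blast
  have "ord x dvd p"
    using subgroup_subset_torsion[OF P(1)] x P by (auto simp: torsion_iff_ord_dvd)
  moreover have "ord x \<noteq> 1" using ord_eq_1 xG x by blast
  ultimately show "ord x = p" using p prime_nat_iff by blast
  moreover have "finite P" using P p prime_gt_0_nat card_ge_0_finite by metis
  ultimately show "generate G {x} = P"
    using sub P generate_pow_card[OF xG] by (simp add: card_subset_eq)
qed

lemma (in group) prime_order_inter:
  assumes "Factorial_Ring.prime p" "subgroup P G" "card P = p"
    and "Factorial_Ring.prime q" "subgroup Q G" "card Q = q" and "P \<noteq> Q"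
  shows "P \<inter> Q = {\<one>}"
proof -
  have "x = \<one>" if "x \<in> P \<inter> Q" for x
    using that assms prime_order_cyclic(1)[of p P x] prime_order_cyclic(1)[of q Q x] by blast
  moreover have "\<one> \<in> P \<inter> Q"
    using assms subgroup.one_closed by blast
  ultimately show ?thesis by blast
qed

lemma (in group) cyclic_subgroups_prime:
  assumes p: "Factorial_Ring.prime p"
  shows "cyclic_subgroups G p = {P. subgroup P G \<and> card P = p}"
proof
  show "cyclic_subgroups G p \<subseteq> {P. subgroup P G \<and> card P = p}"
  proof
    fix P assume "P \<in> cyclic_subgroups G p"
    then obtain x where P: "P = generate G {x}" and "x \<in> {x \<in> carrier G. ord x = p}"
      unfolding cyclic_subgroups_def by (rule imageE)
    then have x: "x \<in> carrier G" "ord x = p" by simp_all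
    have "subgroup P G" unfolding P using x by (intro generate_is_subgroup) simp
    moreover have "card P = p" unfolding P using generate_pow_card[OF x(1)] x(2) by metis
    ultimately show "P \<in> {P. subgroup P G \<and> card P = p}" by simp
  qed
  show "{P. subgroup P G \<and> card P = p} \<subseteq> cyclic_subgroups G p"
  proof
    fix P assume "P \<in> {P. subgroup P G \<and> card P = p}"
    then have P: "subgroup P G" "card P = p" by auto
    have "card P \<noteq> 1" using P p prime_gt_1_nat[of p] by simp
    then have "P \<noteq> {\<one>}" by auto
    then obtain x where x: "x \<in> P" "x \<noteq> \<one>" using subgroup.one_closed[OF P(1)] by blast
    moreover have "x \<in> carrier G" using x P(1) subgroup.subset by blast
    ultimately show "P \<in> cyclic_subgroups G p"
      using prime_order_cyclic[OF p P x] by (auto simp: cyclic_subgroups_def)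
  qed
qed

lemma (in comm_group) generate_Un_subgroups:
  assumes A: "subgroup A G" and B: "subgroup B G"
  shows "generate G (A \<union> B) = A <#> B"
proof (rule generateI[symmetric])
  show "subgroup (A <#> B) G" using A B by (rule mult_subgroups)
  have "a \<otimes> \<one> \<in> A <#> B" if "a \<in> A" for a
    using that subgroup.one_closed[OF B] unfolding set_mult_def by blast
  moreover have "\<one> \<otimes> b \<in> A <#> B" if "b \<in> B" for b
    using that subgroup.one_closed[OF A] unfolding set_mult_def by blast
  ultimately show "A \<union> B \<subseteq> A <#> B"
    using subgroup.mem_carrier[OF A] subgroup.mem_carrier[OF B] by auto
  show "A <#> B \<subseteq> K" if "subgroup K G" "A \<union> B \<subseteq> K" for K
    using that subgroup.m_closed[OF that(1)] by (auto simp: set_mult_def)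
qed

text \<open>The product of the two generators has order p q and generates the join, so the subgroups
  of the join correspond to the divisors 1, p, q and p q.\<close>

lemma (in comm_group) card_below_join_distinct_primes:
  assumes fin: "finite (carrier G)"
    and p: "Factorial_Ring.prime p" and P: "subgroup P G" "card P = p"
    and q: "Factorial_Ring.prime q" and Q: "subgroup Q G" "card Q = q" and "p \<noteq> q"
  shows "card (below G (generate G (P \<union> Q))) \<le> 4"
proof -
  obtain x where x: "x \<in> carrier G" "ord x = p" "P = generate G {x}"
    using P cyclic_subgroups_prime[OF p] unfolding cyclic_subgroups_def by blast
  obtain y where y: "y \<in> carrier G" "ord y = q" "Q = generate G {y}"
    using Q cyclic_subgroups_prime[OF q] unfolding cyclic_subgroups_def by blast
  let ?z = "x \<otimes> y"
  have z: "?z \<in> carrier G" using x y by simp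
  have "ord ?z = p * q"
    using x y p q \<open>p \<noteq> q\<close> by (simp add: ord_mult_coprime primes_coprime)
  moreover have PQ: "P \<inter> Q \<subseteq> {\<one>}"
    using prime_order_inter[OF p P q Q] P Q \<open>p \<noteq> q\<close> by blast
  have "card (P <#> Q) = p * q"
    using card_set_mult_disjoint[OF P(1) Q(1) PQ] P Q by simp
  moreover have "?z \<in> P <#> Q"
    using x y unfolding set_mult_def by (blast intro: generate.incl)
  then have "generate G {?z} \<subseteq> P <#> Q"
    using mult_subgroups[OF P(1) Q(1)] generate_singleton_subset by blast
  moreover have "finite (P <#> Q)"
    using fin mult_subgroups[OF P(1) Q(1)] finite_subset subgroup.subset by blast
  ultimately have eq: "generate G {?z} = P <#> Q"
    using generate_pow_card[OF z] by (simp add: card_subset_eq)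
  have "{d. d dvd p * q} \<subseteq> {1, p, q, p * q}"
  proof
    fix d assume "d \<in> {d. d dvd p * q}"
    then obtain a b where "d = a * b" "a dvd p" "b dvd q"
      by (auto elim: dvd_productE)
    moreover have "a = 1 \<or> a = p" "b = 1 \<or> b = q"
      using p q \<open>a dvd p\<close> \<open>b dvd q\<close> prime_nat_iff by blast+
    ultimately show "d \<in> {1, p, q, p * q}" by auto
  qed
  then have "card {d. d dvd p * q} \<le> card {1, p, q, p * q}"
    by (intro card_mono) auto
  also have "\<dots> \<le> 4" by (simp add: card_insert_if)
  finally show ?thesis
    using bij_betw_same_card[OF bij_betw_card_below_cyclic[OF fin z]] eq \<open>ord ?z = p * q\<close>
      generate_Un_subgroups[OF P(1) Q(1)] by simp
qed

text \<open>The join has order p^2 and is killed by p. Its proper nontrivial subgroups have order p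
  and any two meet trivially, so there are (p^2 - 1) / (p - 1) = p + 1 of them; the trivial subgroup
  and the join itself bring the total to p + 3.\<close>

lemma (in comm_group) card_below_join_same_prime:
  assumes fin: "finite (carrier G)" and p: "Factorial_Ring.prime p"
    and P: "subgroup P G" "card P = p" and Q: "subgroup Q G" "card Q = p" and "P \<noteq> Q"
  shows "card (below G (generate G (P \<union> Q))) = p + 3"
proof -
  let ?V = "P <#> Q"
  have p1: "p > 1" using p prime_gt_1_nat by blast
  have V: "subgroup ?V G" using P Q mult_subgroups by blast
  have finV: "finite ?V" using fin V finite_subset subgroup.subset by blast
  have PQ: "P \<inter> Q \<subseteq> {\<one>}" using prime_order_inter[OF p P p Q] \<open>P \<noteq> Q\<close> by blast
  have cV: "card ?V = p * p"
    using card_set_mult_disjoint[OF P(1) Q(1) PQ] P Q by simp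
  have torV: "?V \<subseteq> torsion G p"
    using subgroup_subset_torsion[OF P(1)] subgroup_subset_torsion[OF Q(1)] P Q
      subgroup.m_closed[OF subgroup_torsion[of p]] by (auto simp: set_mult_def)
  let ?N = "{S. subgroup S G \<and> S \<subseteq> ?V \<and> card S = p}"
  have finN: "finite ?N"
    using finV by (intro finite_subset[of ?N "Pow ?V"]) auto
  have eq: "below G ?V = insert {\<one>} (insert ?V ?N)"
  proof
    show "below G ?V \<subseteq> insert {\<one>} (insert ?V ?N)"
    proof
      fix S assume "S \<in> below G ?V"
      then have S: "subgroup S G" "S \<subseteq> ?V" by (auto simp: below_def subgroups_def)
      have "card S dvd p ^ 2"
        using card_subgroup_dvd[OF S(1) V S(2)] cV by (simp add: power2_eq_square)
      then obtain i where i: "i \<le> 2" "card S = p ^ i"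
        using p divides_primepow_nat by blast
      then consider "card S = 1" | "card S = p" | "card S = p * p"
        by (cases i rule: nat.exhaust; cases "i = 1"; cases "i = 2") (auto simp: power2_eq_square)
      then show "S \<in> insert {\<one>} (insert ?V ?N)"
      proof cases
        case 1
        then have "S = {\<one>}"
          using subgroup.one_closed[OF S(1)] by (auto simp: card_1_singleton_iff)
        then show ?thesis by simp
      next
        case 2
        then show ?thesis using S by simp
      next
        case 3
        then show ?thesis using card_subset_eq[OF finV S(2)] cV by simp
      qed
    qed
    show "insert {\<one>} (insert ?V ?N) \<subseteq> below G ?V"
      using V triv_subgroup subgroup.one_closed[OF V] by (auto simp: below_def subgroups_def)
  qed
  \<comment> \<open>Each nonidentity element has order p and generates the line through it, so the
    lines without the identity partition these elements.\<close>
  have "?V - {\<one>} = (\<Union>S\<in>?N. S - {\<one>})"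
  proof
    show "?V - {\<one>} \<subseteq> (\<Union>S\<in>?N. S - {\<one>})"
    proof
      fix v assume v: "v \<in> ?V - {\<one>}"
      then have vG: "v \<in> carrier G" and "ord v dvd p"
        using torV by (auto simp: torsion_iff_ord_dvd)
      moreover have "ord v \<noteq> 1" using v vG ord_eq_1 by blast
      ultimately have "ord v = p" using p prime_nat_iff by blast
      then have "generate G {v} \<in> ?N"
        using v vG V generate_singleton_subset generate_is_subgroup by (simp flip: generate_pow_card)
      moreover have "v \<in> generate G {v}" by (simp add: generate.incl)
      ultimately show "v \<in> (\<Union>S\<in>?N. S - {\<one>})" using v by blast
    qed
  qed auto
  moreover have "card (\<Union>S\<in>?N. S - {\<one>}) = (\<Sum>S\<in>?N. card (S - {\<one>}))"
  proof (rule card_UN_disjoint[OF finN])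
    show "\<forall>S\<in>?N. finite (S - {\<one>})"
      using finV finite_subset by blast
    show "\<forall>S\<in>?N. \<forall>T\<in>?N. S \<noteq> T \<longrightarrow> (S - {\<one>}) \<inter> (T - {\<one>}) = {}"
      using prime_order_inter[OF p _ _ p] by blast
  qed
  moreover have "card (S - {\<one>}) = p - 1" if "S \<in> ?N" for S
    using that subgroup.one_closed[of S G] by (auto simp: card_Diff_singleton)
  moreover have "card (?V - {\<one>}) = p * p - 1"
    using cV subgroup.one_closed[OF V] by simp
  ultimately have "p * p - 1 = card ?N * (p - 1)" by simp
  moreover have "p * p - 1 = (p + 1) * (p - 1)"
    using p1 by (simp add: algebra_simps)
  ultimately have "card ?N * (p - 1) = (p + 1) * (p - 1)"
    by (simp only:)
  then have "card ?N = p + 1"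
    using p1 by (subst (asm) mult_cancel2) simp
  moreover have "card S \<noteq> 1" if "S \<in> insert ?V ?N" for S
    using that p1 cV by auto
  then have "{\<one>} \<notin> insert ?V ?N"
    by (metis card_1_singleton_iff One_nat_def)
  moreover have "?V \<notin> ?N"
    using p1 cV by simp
  ultimately show ?thesis
    using eq finN generate_Un_subgroups[OF P(1) Q(1)] by simp
qed

section \<open>Counting elements through cyclic subgroups\<close>

lemma (in group) card_ord_eq_cyclic_subgroups:
  assumes fin: "finite (carrier G)"
  shows "card {x \<in> carrier G. ord x = n} = card (cyclic_subgroups G n) * phi' n"
proof -
  let ?O = "{x \<in> carrier G. ord x = n}"
  \<comment> \<open>The sum runs over the fibres of x to <x>; each fibre is the set of generators of
    one cyclic subgroup, and their number is Euler's totient \<open>phi'\<close>.\<close>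
  have "card ?O = (\<Sum>C\<in>cyclic_subgroups G n. card {x \<in> ?O. generate G {x} = C})"
    unfolding cyclic_subgroups_def card_eq_sum using fin by (intro sum.image_gen) simp
  also have "\<dots> = (\<Sum>C\<in>cyclic_subgroups G n. phi' n)"
  proof (rule sum.cong[OF refl])
    fix C assume "C \<in> cyclic_subgroups G n"
    then obtain a where a: "a \<in> carrier G" "ord a = n" "C = generate G {a}"
      unfolding cyclic_subgroups_def by blast
    have n: "n > 0" using ord_ge_1[OF fin a(1)] a by simp
    have C: "subgroup C G" using a generate_is_subgroup by simp
    have finC: "finite C" using fin C finite_subset subgroup.subset by blast
    have Cpow: "C = {a [^] k | k. k \<in> (UNIV :: nat set)}"
      using generate_pow_on_finite_carrier[OF fin a(1)] a by simp
    have "{x \<in> ?O. generate G {x} = C} = ([^]) a ` {k. 1 \<le> k \<and> k \<le> n \<and> coprime k n}"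
    proof
      show "{x \<in> ?O. generate G {x} = C} \<subseteq> ([^]) a ` {k. 1 \<le> k \<and> k \<le> n \<and> coprime k n}"
      proof
        fix x assume "x \<in> {x \<in> ?O. generate G {x} = C}"
        then have x: "x \<in> carrier G" "ord x = n" "x \<in> C"
          by (auto intro: generate.incl)
        then obtain k :: nat where k: "x = a [^] k" using Cpow by auto
        \<comment> \<open>\<open>phi'\<close> counts exponents from 1 to n, so the residue 0 is
          represented by n.\<close>
        define l where "l = (if k mod n = 0 then n else k mod n)"
        have "a [^] k = a [^] (k mod n) \<otimes> (a [^] n) [^] (k div n)"
          using a by (simp add: nat_pow_pow nat_pow_mult)
        also have "\<dots> = a [^] l"
          using a pow_ord_eq_1[OF a(1)] by (auto simp: l_def)
        finally have "x = a [^] l" using k by simp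
        moreover have "1 \<le> l" "l \<le> n" using n by (auto simp: l_def less_imp_le)
        moreover have "coprime l n"
          using pow_ord_eq_ord_iff[OF fin a(1), of l] a x \<open>x = a [^] l\<close> by simp
        ultimately show "x \<in> ([^]) a ` {k. 1 \<le> k \<and> k \<le> n \<and> coprime k n}" by blast
      qed
      show "([^]) a ` {k. 1 \<le> k \<and> k \<le> n \<and> coprime k n} \<subseteq> {x \<in> ?O. generate G {x} = C}"
      proof
        fix x assume "x \<in> ([^]) a ` {k. 1 \<le> k \<and> k \<le> n \<and> coprime k n}"
        then obtain k :: nat where k: "x = a [^] k" "coprime k n" by blast
        then have x: "x \<in> carrier G" "ord x = n"
          using pow_ord_eq_ord_iff[OF fin a(1), of k] a by auto
        moreover have "x \<in> C" using Cpow k by auto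
        then have "generate G {x} = C"
          using generate_singleton_subset[OF C] finC x a
          by (intro card_subset_eq) (simp_all flip: generate_pow_card)
        ultimately show "x \<in> {x \<in> ?O. generate G {x} = C}" by simp
      qed
    qed
    moreover have "inj_on (([^]) a) {k. 1 \<le> k \<and> k \<le> n \<and> coprime k n}"
      using ord_inj'[OF a(1)] a by (auto intro: inj_on_subset)
    ultimately show "card {x \<in> ?O. generate G {x} = C} = phi' n"
      by (simp add: card_image phi'_def)
  qed
  finally show ?thesis by simp
qed

lemma (in group) card_torsion_prime_power:
  assumes fin: "finite (carrier G)" and p: "Factorial_Ring.prime p"
  shows "card (torsion G (p ^ k)) = (\<Sum>i\<le>k. card (cyclic_subgroups G (p ^ i)) * phi' (p ^ i))"
proof -
  have "torsion G (p ^ k) = (\<Union>i\<le>k. {x \<in> carrier G. ord x = p ^ i})"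
    using p by (auto simp: torsion_iff_ord_dvd divides_primepow_nat)
  also have "card \<dots> = (\<Sum>i\<le>k. card {x \<in> carrier G. ord x = p ^ i})"
  proof (rule card_UN_disjoint)
    show "\<forall>i\<in>{..k}. \<forall>j\<in>{..k}. i \<noteq> j \<longrightarrow>
        {x \<in> carrier G. ord x = p ^ i} \<inter> {x \<in> carrier G. ord x = p ^ j} = {}"
      using prime_gt_1_nat[OF p] by auto
  qed (use fin in auto)
  finally show ?thesis
    by (simp add: card_ord_eq_cyclic_subgroups[OF fin])
qed

section \<open>Lattice isomorphisms and direct powers\<close>

text \<open>Keeping only the inclusion order makes inverses and restrictions to lower intervals
  immediate; joins are recovered as least upper bounds.\<close>

definition subgroup_order_iso ::
  "('a, 'b) monoid_scheme \<Rightarrow> ('c, 'd) monoid_scheme \<Rightarrow> ('a set \<Rightarrow> 'c set) \<Rightarrow> bool" where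
  "subgroup_order_iso K L f \<longleftrightarrow> bij_betw f (subgroups K) (subgroups L) \<and>
     (\<forall>A\<in>subgroups K. \<forall>B\<in>subgroups K. A \<subseteq> B \<longleftrightarrow> f A \<subseteq> f B)"

text \<open>This is the form in which n >= 2 enters the comparison of the lattices, which can then
  be carried out for groups that are not given as powers.\<close>

definition prime_subgroups_paired :: "('a, 'b) monoid_scheme \<Rightarrow> bool" where
  "prime_subgroups_paired K \<longleftrightarrow> (\<forall>P. subgroup P K \<longrightarrow> Factorial_Ring.prime (card P) \<longrightarrow>
     (\<exists>Q. subgroup Q K \<and> card Q = card P \<and> Q \<noteq> P))"

lemma subgroup_lattice_iso_imp_order_iso:
  assumes K: "group K" and f: "subgroup_lattice_iso K L f"
  shows "subgroup_order_iso K L f"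
proof -
  have bij: "bij_betw f (subgroups K) (subgroups L)"
    and int: "\<And>A B. A \<in> subgroups K \<Longrightarrow> B \<in> subgroups K \<Longrightarrow> f (A \<inter> B) = f A \<inter> f B"
    using f by (auto simp: subgroup_lattice_iso_def)
  have "A \<subseteq> B \<longleftrightarrow> f A \<subseteq> f B" if A: "A \<in> subgroups K" and B: "B \<in> subgroups K" for A B
  proof -
    have AB: "A \<inter> B \<in> subgroups K"
      using A B group.subgroups_Inter_pair[OF K] by (simp add: subgroups_def)
    have "A \<subseteq> B \<longleftrightarrow> A \<inter> B = A" by blast
    also have "\<dots> \<longleftrightarrow> f (A \<inter> B) = f A"
      using inj_on_eq_iff[OF bij_betw_imp_inj_on[OF bij] AB A] by simp
    also have "\<dots> \<longleftrightarrow> f A \<subseteq> f B"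
      unfolding int[OF A B] by blast
    finally show ?thesis .
  qed
  then show ?thesis using bij by (simp add: subgroup_order_iso_def)
qed

lemma subgroup_order_iso_inv:
  assumes "subgroup_order_iso K L f"
  shows "subgroup_order_iso L K (inv_into (subgroups K) f)"
proof -
  let ?g = "inv_into (subgroups K) f"
  have bij: "bij_betw f (subgroups K) (subgroups L)"
    and ord: "\<And>A B. A \<in> subgroups K \<Longrightarrow> B \<in> subgroups K \<Longrightarrow> A \<subseteq> B \<longleftrightarrow> f A \<subseteq> f B"
    using assms by (auto simp: subgroup_order_iso_def)
  have g: "bij_betw ?g (subgroups L) (subgroups K)"
    using bij by (rule bij_betw_inv_into)
  have "A \<subseteq> B \<longleftrightarrow> ?g A \<subseteq> ?g B" if "A \<in> subgroups L" "B \<in> subgroups L" for A B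
    using that ord[OF bij_betwE[OF g, rule_format, OF that(1)] bij_betwE[OF g, rule_format, OF that(2)]]
    by (simp add: bij_betw_inv_into_right[OF bij])
  then show ?thesis using g by (simp add: subgroup_order_iso_def)
qed

lemma subgroup_order_iso_below:
  assumes f: "subgroup_order_iso K L f" and C: "C \<in> subgroups K"
  shows "bij_betw f (below K C) (below L (f C))"
proof -
  have bij: "bij_betw f (subgroups K) (subgroups L)"
    and ord: "\<And>A B. A \<in> subgroups K \<Longrightarrow> B \<in> subgroups K \<Longrightarrow> A \<subseteq> B \<longleftrightarrow> f A \<subseteq> f B"
    using f by (auto simp: subgroup_order_iso_def)
  have "f ` below K C = below L (f C)"
  proof
    show "f ` below K C \<subseteq> below L (f C)"
      using ord C bij_betwE[OF bij] by (auto simp: below_def)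
    show "below L (f C) \<subseteq> f ` below K C"
    proof
      fix B assume "B \<in> below L (f C)"
      then have B: "B \<in> subgroups L" "B \<subseteq> f C" by (auto simp: below_def)
      then obtain A where "A \<in> subgroups K" "B = f A"
        using bij_betw_imp_surj_on[OF bij] by blast
      then show "B \<in> f ` below K C"
        using B ord C by (auto simp: below_def)
    qed
  qed
  moreover have "inj_on f (below K C)"
    using bij_betw_imp_inj_on[OF bij] by (rule inj_on_subset) (auto simp: below_def)
  ultimately show ?thesis by (simp add: bij_betw_def)
qed

text \<open>A subgroup above both images is the image of a subgroup above \<open>A\<close> and
  \<open>B\<close>, hence above their join.\<close>

lemma subgroup_order_iso_join:
  assumes K: "group K" and L: "group L" and f: "subgroup_order_iso K L f"
    and A: "A \<in> subgroups K" and B: "B \<in> subgroups K"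
  shows "f (generate K (A \<union> B)) = generate L (f A \<union> f B)"
proof -
  interpret K: group K by fact
  interpret L: group L by fact
  have bij: "bij_betw f (subgroups K) (subgroups L)"
    and ord: "\<And>A B. A \<in> subgroups K \<Longrightarrow> B \<in> subgroups K \<Longrightarrow> A \<subseteq> B \<longleftrightarrow> f A \<subseteq> f B"
    using f by (auto simp: subgroup_order_iso_def)
  have fA: "f A \<in> subgroups L" and fB: "f B \<in> subgroups L"
    using A B bij_betwE[OF bij] by auto
  have J: "generate K (A \<union> B) \<in> subgroups K"
    using A B K.generate_is_subgroup[of "A \<union> B"] subgroup.subset by (auto simp: subgroups_def)
  have AJ: "A \<subseteq> generate K (A \<union> B)" "B \<subseteq> generate K (A \<union> B)"
    by (auto intro: generate.incl)
  show ?thesis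
  proof (rule L.generateI)
    show "subgroup (f (generate K (A \<union> B))) L"
      using J bij_betwE[OF bij] by (auto simp: subgroups_def)
    show "f A \<union> f B \<subseteq> f (generate K (A \<union> B))"
      using AJ ord[OF A J] ord[OF B J] by simp
    fix M assume M: "subgroup M L" "f A \<union> f B \<subseteq> M"
    then have "M \<in> f ` subgroups K"
      using bij_betw_imp_surj_on[OF bij] by (metis mem_Collect_eq subgroups_def)
    then obtain R where R: "R \<in> subgroups K" "M = f R" by blast
    then have "A \<union> B \<subseteq> R"
      using M ord A B by auto
    then have "generate K (A \<union> B) \<subseteq> R"
      using K.generate_subgroup_incl R by (simp add: subgroups_def)
    then show "f (generate K (A \<union> B)) \<subseteq> M"
      using ord[OF J R(1)] R by simp
  qed
qed

text \<open>Chain and length are order-theoretic, so the exponent survives; the prime q is still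
  unrelated to p at this stage.\<close>

lemma subgroup_order_iso_cyclic_chain:
  assumes K: "group K" "finite (carrier K)" and L: "group L" "finite (carrier L)"
    and f: "subgroup_order_iso K L f" and p: "Factorial_Ring.prime p" and k: "k > 0"
    and C: "C \<in> cyclic_subgroups K (p ^ k)"
  obtains q where "Factorial_Ring.prime q" "f C \<in> cyclic_subgroups L (q ^ k)"
proof -
  have bij: "bij_betw f (subgroups K) (subgroups L)"
    and ord: "\<And>A B. A \<in> subgroups K \<Longrightarrow> B \<in> subgroups K \<Longrightarrow> A \<subseteq> B \<longleftrightarrow> f A \<subseteq> f B"
    using f by (auto simp: subgroup_order_iso_def)
  note chain = group.below_cyclic_prime_power[OF K p C]
  have below: "bij_betw f (below K C) (below L (f C))"
    using f chain(1) by (rule subgroup_order_iso_below)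
  show thesis
  proof (rule group.cyclic_prime_powerI[OF L _ k])
    show "f C \<in> subgroups L"
      using chain(1) bij_betwE[OF bij] by blast
    show "card (below L (f C)) = Suc k"
      using bij_betw_same_card[OF below] chain(2) by simp
    show "A' \<subseteq> B' \<or> B' \<subseteq> A'" if A': "A' \<in> below L (f C)" and B': "B' \<in> below L (f C)" for A' B'
    proof -
      have "A' \<in> f ` below K C" "B' \<in> f ` below K C"
        using A' B' bij_betw_imp_surj_on[OF below] by simp_all
      then obtain A B where A: "A \<in> below K C" "A' = f A" and B: "B \<in> below K C" "B' = f B"
        by blast
      then have "A \<in> subgroups K" "B \<in> subgroups K" by (simp_all add: below_def)
      then show ?thesis
        using chain(3)[OF A(1) B(1)] ord A B by blast
    qed
  qed (rule that)
qed

text \<open>A prime \<open>p\<close> is visible in the lattice because the join of two distinct subgroups of order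
  \<open>p\<close> contains exactly \<open>p + 3\<close> subgroups, and that of two subgroups of distinct prime orders
  at most four.\<close>

lemma subgroup_order_iso_card_prime:
  assumes K: "comm_group K" "finite (carrier K)" and L: "comm_group L" "finite (carrier L)"
    and pair: "prime_subgroups_paired K" and f: "subgroup_order_iso K L f"
    and p: "Factorial_Ring.prime p" and P: "subgroup P K" "card P = p"
  shows "card (f P) = p"
proof -
  interpret K: comm_group K by fact
  interpret L: comm_group L by fact
  have inj: "inj_on f (subgroups K)"
    using f by (auto simp: subgroup_order_iso_def bij_betw_def)
  obtain Q where Q: "subgroup Q K" "card Q = p" "Q \<noteq> P"
    using pair P p by (auto simp: prime_subgroups_paired_def)
  have sub: "P \<in> subgroups K" "Q \<in> subgroups K" using P Q by (auto simp: subgroups_def)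
  \<comment> \<open>Prime order corresponds to a chain with two members, so the images have prime
    orders, a priori different ones.\<close>
  have image: "\<exists>q. Factorial_Ring.prime q \<and> subgroup (f S) L \<and> card (f S) = q"
    if S: "subgroup S K" "card S = p" for S
  proof -
    have "S \<in> cyclic_subgroups K (p ^ 1)"
      using S K.cyclic_subgroups_prime[OF p] by simp
    then obtain q where q: "Factorial_Ring.prime q" "f S \<in> cyclic_subgroups L (q ^ 1)"
      using subgroup_order_iso_cyclic_chain[OF K.group_axioms K(2) L.group_axioms L(2) f p, of 1]
      by auto
    then show ?thesis
      using L.cyclic_subgroups_prime[OF q(1)] by auto
  qed
  obtain r where r: "Factorial_Ring.prime r" "subgroup (f P) L" "card (f P) = r"
    using image[OF P] by blast
  obtain s where s: "Factorial_Ring.prime s" "subgroup (f Q) L" "card (f Q) = s"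
    using image[OF Q(1,2)] by blast
  have ne: "f P \<noteq> f Q" using inj_on_eq_iff[OF inj sub] Q by blast
  have "generate K (P \<union> Q) \<in> subgroups K"
    using K.generate_is_subgroup P Q subgroup.subset by (metis Un_least mem_Collect_eq subgroups_def)
  then have "card (below K (generate K (P \<union> Q))) = card (below L (f (generate K (P \<union> Q))))"
    using subgroup_order_iso_below[OF f] bij_betw_same_card by blast
  then have eq: "card (below L (generate L (f P \<union> f Q))) = p + 3"
    using subgroup_order_iso_join[OF K.group_axioms L.group_axioms f sub]
      K.card_below_join_same_prime[OF K(2) p P Q(1,2)] Q(3) by simp
  have "r = s"
  proof (rule ccontr)
    assume "r \<noteq> s"
    then have "p + 3 \<le> 4"
      using L.card_below_join_distinct_primes[OF L(2) r s] eq by simp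
    then show False using prime_gt_1_nat[OF p] by simp
  qed
  then have "r + 3 = p + 3"
    using L.card_below_join_same_prime[OF L(2) r, of "f Q"] s ne eq by simp
  then show ?thesis using r by simp
qed

text \<open>The prime is tested at the bottom of the chain: the subgroup of order p in
  \<open>C\<close> has an image of order p inside \<open>f C\<close>, so p divides q^k.\<close>

lemma subgroup_order_iso_cyclic_subgroups:
  assumes K: "comm_group K" "finite (carrier K)" and L: "comm_group L" "finite (carrier L)"
    and pair: "prime_subgroups_paired K" and f: "subgroup_order_iso K L f"
    and p: "Factorial_Ring.prime p" and k: "k > 0"
  shows "f ` cyclic_subgroups K (p ^ k) \<subseteq> cyclic_subgroups L (p ^ k)"
proof
  interpret K: comm_group K by fact
  interpret L: comm_group L by fact
  fix D assume "D \<in> f ` cyclic_subgroups K (p ^ k)"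
  then obtain C where C: "C \<in> cyclic_subgroups K (p ^ k)" and D: "D = f C" by (rule imageE)
  obtain q where q: "Factorial_Ring.prime q" "f C \<in> cyclic_subgroups L (q ^ k)"
    using subgroup_order_iso_cyclic_chain[OF K.group_axioms K(2) L.group_axioms L(2) f p k C] by blast
  obtain x where x: "x \<in> carrier K" "K.ord x = p ^ k" "C = generate K {x}"
    using C by (auto simp: cyclic_subgroups_def)
  obtain y where y: "y \<in> carrier L" "L.ord y = q ^ k" "f C = generate L {y}"
    using q by (auto simp: cyclic_subgroups_def)
  have CK: "C \<in> subgroups K" using K.below_cyclic_prime_power(1)[OF K(2) p C] .
  have "p \<in> card ` below K C"
    using K.bij_betw_card_below_cyclic[OF K(2) x(1)] x k by (simp add: bij_betw_def)
  then obtain P where P: "P \<in> below K C" "card P = p" by blast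
  then have "f P \<in> below L (f C)"
    using bij_betwE[OF subgroup_order_iso_below[OF f CK]] by blast
  then have "card (f P) dvd card (f C)"
    using L.card_subgroup_dvd[of "f P" "f C"] L.generate_is_subgroup[of "{y}"] y
    by (simp add: below_def subgroups_def)
  moreover have "card (f P) = p"
    using subgroup_order_iso_card_prime[OF K L pair f p _ P(2)] P(1) by (simp add: below_def subgroups_def)
  ultimately have "p dvd q ^ k"
    using L.generate_pow_card[OF y(1)] y by simp
  then have "p = q"
    using p q by (metis prime_dvd_power primes_dvd_imp_eq)
  then show "D \<in> cyclic_subgroups L (p ^ k)" using q D by simp
qed

text \<open>Only one inequality, since the pairing is assumed on the side of \<open>K\<close>; the
  inverse of \<open>f\<close> supplies the other once \<open>L\<close> is paired too.\<close>

lemma card_cyclic_subgroups_le: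
  assumes K: "comm_group K" "finite (carrier K)" and L: "comm_group L" "finite (carrier L)"
    and pair: "prime_subgroups_paired K" and f: "subgroup_order_iso K L f"
    and p: "Factorial_Ring.prime p" and k: "k > 0"
  shows "card (cyclic_subgroups K (p ^ k)) \<le> card (cyclic_subgroups L (p ^ k))"
proof (rule card_inj_on_le)
  interpret K: comm_group K by fact
  show "f ` cyclic_subgroups K (p ^ k) \<subseteq> cyclic_subgroups L (p ^ k)"
    by (rule subgroup_order_iso_cyclic_subgroups[OF assms])
  show "finite (cyclic_subgroups L (p ^ k))"
    using L(2) by (simp add: cyclic_subgroups_def)
  have "inj_on f (subgroups K)"
    using f by (auto simp: subgroup_order_iso_def bij_betw_def)
  then show "inj_on f (cyclic_subgroups K (p ^ k))"
    by (rule inj_on_subset) (use K.below_cyclic_prime_power(1)[OF K(2) p] in blast)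
qed

lemma (in group) card_cyclic_subgroups_1: "card (cyclic_subgroups G 1) = 1"
proof -
  have "{x \<in> carrier G. ord x = 1} = {\<one>}"
    using ord_eq_1 by blast
  then show ?thesis unfolding cyclic_subgroups_def by simp
qed

lemma subgroup_order_iso_card_torsion:
  assumes K: "comm_group K" "finite (carrier K)" and L: "comm_group L" "finite (carrier L)"
    and pair: "prime_subgroups_paired K" "prime_subgroups_paired L"
    and f: "subgroup_order_iso K L f" and p: "Factorial_Ring.prime p"
  shows "card (torsion K (p ^ k)) = card (torsion L (p ^ k))"
proof -
  interpret K: comm_group K by fact
  interpret L: comm_group L by fact
  have "card (cyclic_subgroups K (p ^ i)) = card (cyclic_subgroups L (p ^ i))" for i
  \<comment> \<open>The transfer covers positive exponents; for exponent 0 both sides count just the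
    trivial subgroup.\<close>
  proof (cases "i = 0")
    case True
    then show ?thesis using K.card_cyclic_subgroups_1 L.card_cyclic_subgroups_1 by simp
  next
    case False
    then show ?thesis
      using card_cyclic_subgroups_le[OF K L pair(1) f p]
        card_cyclic_subgroups_le[OF L K pair(2) subgroup_order_iso_inv[OF f] p]
      by (simp add: le_antisym)
  qed
  then show ?thesis
    by (simp add: K.card_torsion_prime_power[OF K(2) p] L.card_torsion_prime_power[OF L(2) p])
qed

section \<open>Torsion and prime order subgroups in direct powers\<close>

lemma group_power_group: "group G \<Longrightarrow> group (group_power G n)"
  by (simp add: group_power_def)

lemma group_power_comm_group:
  assumes "comm_group G"
  shows "comm_group (group_power G n)"
proof (rule group.group_comm_groupI)
  interpret comm_group G by fact
  show "group (group_power G n)" using group_axioms by (rule group_power_group)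
  show "x \<otimes>\<^bsub>group_power G n\<^esub> y = y \<otimes>\<^bsub>group_power G n\<^esub> x"
    if "x \<in> carrier (group_power G n)" "y \<in> carrier (group_power G n)" for x y
    using that by (auto simp: group_power_def PiE_iff m_comm intro!: restrict_ext)
qed

lemma finite_group_power:
  "finite (carrier G) \<Longrightarrow> finite (carrier (group_power G n))"
  by (simp add: group_power_def finite_PiE)

lemma group_power_pow:
  fixes m :: nat
  assumes "group G" "x \<in> carrier (group_power G n)"
  shows "x [^]\<^bsub>group_power G n\<^esub> m = (\<lambda>i\<in>{..<n}. x i [^]\<^bsub>G\<^esub> m)"
proof (induction m)
  case 0
  show ?case by (simp add: group_power_def nat_pow_def)
next
  case (Suc m)
  interpret G: group G by fact
  interpret P: group "group_power G n" using assms(1) by (rule group_power_group)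
  have "x [^]\<^bsub>group_power G n\<^esub> Suc m = x [^]\<^bsub>group_power G n\<^esub> m \<otimes>\<^bsub>group_power G n\<^esub> x"
    by simp
  also have "\<dots> = (\<lambda>i\<in>{..<n}. x i [^]\<^bsub>G\<^esub> Suc m)"
    unfolding Suc.IH by (auto simp: group_power_def intro!: restrict_ext)
  finally show ?case .
qed

lemma card_torsion_group_power:
  assumes "group G"
  shows "card (torsion (group_power G n) m) = card (torsion G m) ^ n"
proof -
  have "torsion (group_power G n) m = (\<Pi>\<^sub>E i\<in>{..<n}. torsion G m)"
  proof (rule Set.set_eqI)
    fix x
    have "x \<in> torsion (group_power G n) m \<longleftrightarrow>
        x \<in> carrier (group_power G n) \<and> (\<lambda>i\<in>{..<n}. x i [^]\<^bsub>G\<^esub> m) = (\<lambda>i\<in>{..<n}. \<one>\<^bsub>G\<^esub>)"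
      using group_power_pow[OF assms] by (auto simp: torsion_def group_power_def)
    also have "\<dots> \<longleftrightarrow> x \<in> carrier (group_power G n) \<and> (\<forall>i<n. x i [^]\<^bsub>G\<^esub> m = \<one>\<^bsub>G\<^esub>)"
      by (auto simp: restrict_def fun_eq_iff)
    also have "\<dots> \<longleftrightarrow> x \<in> (\<Pi>\<^sub>E i\<in>{..<n}. torsion G m)"
      by (auto simp: group_power_def torsion_def PiE_iff)
    finally show "x \<in> torsion (group_power G n) m \<longleftrightarrow> x \<in> (\<Pi>\<^sub>E i\<in>{..<n}. torsion G m)" .
  qed
  then show ?thesis by (simp add: card_PiE)
qed

text \<open>A subgroup of order p in the power forces at least p elements of p-torsion in
  \<open>G\<close>, hence at least p^n > p in the power. Some element of order p therefore lies
  outside \<open>P\<close> and generates the partner.\<close>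

lemma prime_subgroups_paired_group_power:
  fixes G :: "('a, 'b) monoid_scheme"
  assumes G: "comm_group G" "finite (carrier G)" and n: "n \<ge> 2"
  shows "prime_subgroups_paired (group_power G n)"
  unfolding prime_subgroups_paired_def
proof (intro allI impI)
  fix P :: "(nat \<Rightarrow> 'a) set"
  let ?K = "group_power G n" and ?p = "card P"
  interpret G: comm_group G by fact
  interpret K: comm_group "group_power G n" using G(1) by (rule group_power_comm_group)
  assume P: "subgroup P ?K" and p: "Factorial_Ring.prime ?p"
  have finK: "finite (torsion ?K ?p)"
    using finite_group_power[OF G(2), of n] by (auto simp: torsion_def)
  have finG: "finite (torsion G ?p)" using G(2) by (simp add: torsion_def)
  have p1: "?p > 1" using prime_gt_1_nat[OF p] .
  have cK: "card (torsion ?K ?p) = card (torsion G ?p) ^ n"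
    by (rule card_torsion_group_power[OF G.group_axioms])
  have "?p \<le> card (torsion ?K ?p)"
    using K.subgroup_subset_torsion[OF P] finK by (rule card_mono[rotated])
  \<comment> \<open>Otherwise its n-th power, the torsion count of \<open>?K\<close>, would be 1 and
    could not reach p.\<close>
  then have "card (torsion G ?p) \<noteq> 1"
    using p1 cK by auto
  then have "torsion G ?p \<noteq> {\<one>\<^bsub>G\<^esub>}" by auto
  then obtain a where a: "a \<in> torsion G ?p" "a \<noteq> \<one>\<^bsub>G\<^esub>"
    using subgroup.one_closed[OF G.subgroup_torsion] by blast
  then have aG: "a \<in> carrier G" and "G.ord a dvd ?p" by (auto simp: G.torsion_iff_ord_dvd)
  moreover have "G.ord a \<noteq> 1" using a aG G.ord_eq_1 by blast
  ultimately have "G.ord a = ?p" using p prime_nat_iff by blast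
  then have "?p \<le> card (torsion G ?p)"
    using card_mono[OF finG G.generate_singleton_subset[OF G.subgroup_torsion a(1)]]
      G.generate_pow_card[OF aG] by simp
  moreover have "?p < ?p ^ 2" using p1 by (simp add: power2_eq_square)
  moreover have "?p ^ 2 \<le> ?p ^ n" using n p1 by (intro power_increasing) auto
  ultimately have "?p < card (torsion ?K ?p)"
    unfolding cK by (meson less_le_trans power_mono zero_le)
  then have "\<not> torsion ?K ?p \<subseteq> P"
    using card_mono[of P "torsion ?K ?p"] p1 card_ge_0_finite[of P] by linarith
  then obtain y where y: "y \<in> torsion ?K ?p" "y \<notin> P" by blast
  then have yK: "y \<in> carrier ?K" and "K.ord y dvd ?p" by (auto simp: K.torsion_iff_ord_dvd)
  moreover have "y \<noteq> \<one>\<^bsub>?K\<^esub>" using y subgroup.one_closed[OF P] by blast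
  then have "K.ord y \<noteq> 1" using yK K.ord_eq_1 by blast
  ultimately have "K.ord y = ?p" using p prime_nat_iff by blast
  then have "card (generate ?K {y}) = ?p"
    using K.generate_pow_card[OF yK] by simp
  moreover have "subgroup (generate ?K {y}) ?K"
    using yK by (intro K.generate_is_subgroup) simp
  moreover have "generate ?K {y} \<noteq> P"
    using y generate.incl[of y "{y}" ?K] by auto
  ultimately show "\<exists>Q. subgroup Q ?K \<and> card Q = ?p \<and> Q \<noteq> P" by blast
qed

section \<open>From group isomorphisms to lattice isomorphisms, and the equivalence\<close>

lemma iso_imp_subgroup_lattices_isomorphic:
  assumes K: "group K" and L: "group L" and "K \<cong> L"
  shows "subgroup_lattices_isomorphic K L"
proof -
  obtain h where h: "h \<in> iso K L" using \<open>K \<cong> L\<close> by (auto simp: is_iso_def)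
  then have bij: "bij_betw h (carrier K) (carrier L)" and hom: "h \<in> hom K L"
    by (auto simp: iso_def)
  interpret h: group_hom K L h
    using K L hom by (simp add: group_hom_def group_hom_axioms_def)
  have inj: "inj_on h (carrier K)" using bij by (rule bij_betw_imp_inj_on)
  have sub: "A \<subseteq> carrier K" if "A \<in> subgroups K" for A
    using that subgroup.subset by (auto simp: subgroups_def)
  obtain g where g: "g \<in> iso L K" and hg: "\<And>y. y \<in> carrier L \<Longrightarrow> h (g y) = y"
    using h h.G.iso_set_sym[OF h] bij_betw_inv_into_right[OF bij] by blast
  interpret g: group_hom L K g
    using K L g by (simp add: group_hom_def group_hom_axioms_def iso_def)
  have "subgroup_lattice_iso K L ((`) h)"
    unfolding subgroup_lattice_iso_def
  proof (intro conjI ballI)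
    show "bij_betw ((`) h) (subgroups K) (subgroups L)"
      unfolding bij_betw_def
    proof
      show "inj_on ((`) h) (subgroups K)"
        using sub inj_on_image_eq_iff[OF inj] by (auto simp: inj_on_def)
      show "(`) h ` subgroups K = subgroups L"
      proof
        show "(`) h ` subgroups K \<subseteq> subgroups L"
          using h.subgroup_img_is_subgroup by (auto simp: subgroups_def)
        show "subgroups L \<subseteq> (`) h ` subgroups K"
        proof
          fix B assume "B \<in> subgroups L"
          then have B: "subgroup B L" by (simp add: subgroups_def)
          have "h (g y) = y" if "y \<in> B" for y
            using that hg subgroup.subset[OF B] by blast
          then have "h ` g ` B = B"
            by (simp add: image_image)
          moreover have "g ` B \<in> subgroups K"
            using g.subgroup_img_is_subgroup[OF B] by (simp add: subgroups_def)
          ultimately show "B \<in> (`) h ` subgroups K" by blast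
        qed
      qed
    qed
    fix A B assume A: "A \<in> subgroups K" and B: "B \<in> subgroups K"
    show "h ` (A \<inter> B) = h ` A \<inter> h ` B"
      using inj_on_image_Int[OF inj] sub A B by blast
    show "h ` generate K (A \<union> B) = generate L (h ` A \<union> h ` B)"
      using h.generate_img[of "A \<union> B"] sub A B by (simp add: image_Un)
  qed
  then show ?thesis by (auto simp: subgroup_lattices_isomorphic_def)
qed

theorem theorem2:
  fixes G :: "('a, 'b) monoid_scheme" and H :: "('c, 'd) monoid_scheme"
  assumes "comm_group G" and "finite (carrier G)"
      and "comm_group H" and "finite (carrier H)"
  shows "G \<cong> H \<longleftrightarrow>
    (\<exists>n::nat. n \<ge> 2 \<and> subgroup_lattices_isomorphic (group_power G n) (group_power H n))"
proof
  interpret G: comm_group G by fact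
  interpret H: comm_group H by fact
  assume "G \<cong> H"
  \<comment> \<open>One exponent suffices as a witness; the smallest admissible one is
    taken.\<close>
  then have "group_power G 2 \<cong> group_power H 2"
    unfolding group_power_def using G.group_axioms H.group_axioms by (intro iso_product_groupI)
  then have "subgroup_lattices_isomorphic (group_power G 2) (group_power H 2)"
    using G.group_axioms H.group_axioms
    by (intro iso_imp_subgroup_lattices_isomorphic group_power_group)
  then show "\<exists>n::nat. n \<ge> 2 \<and> subgroup_lattices_isomorphic (group_power G n) (group_power H n)"
    by blast
next
  interpret G: comm_group G by fact
  interpret H: comm_group H by fact
  assume "\<exists>n::nat. n \<ge> 2 \<and> subgroup_lattices_isomorphic (group_power G n) (group_power H n)"
  then obtain n f where n: "n \<ge> 2" and f: "subgroup_lattice_iso (group_power G n) (group_power H n) f"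
    by (auto simp: subgroup_lattices_isomorphic_def)
  have "card (torsion G (p ^ k)) = card (torsion H (p ^ k))" if p: "Factorial_Ring.prime p" for p k
  proof -
    have "card (torsion (group_power G n) (p ^ k)) = card (torsion (group_power H n) (p ^ k))"
      using group_power_comm_group[OF assms(1)] finite_group_power[OF assms(2)]
        group_power_comm_group[OF assms(3)] finite_group_power[OF assms(4)]
        prime_subgroups_paired_group_power[OF assms(1,2) n]
        prime_subgroups_paired_group_power[OF assms(3,4) n]
        subgroup_lattice_iso_imp_order_iso[OF group_power_group[OF G.group_axioms] f] p
      by (rule subgroup_order_iso_card_torsion)
    then have "card (torsion G (p ^ k)) ^ n = card (torsion H (p ^ k)) ^ n"
      by (simp add: card_torsion_group_power G.group_axioms H.group_axioms)
    \<comment> \<open>Since n > 0, taking n-th powers is injective on the natural numbers.\<close>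
    then show ?thesis
      using n by (simp add: power_eq_iff_eq_base)
  qed
  then have "card (torsion G m) = card (torsion H m)" for m
    using card_torsion_eqI[OF assms] by blast
  then show "G \<cong> H"
    using finite_comm_groups_iso_if_card_torsion_eq[OF assms] by blast
qed

end
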